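(* Let $t$, $s$ and $p$ be nonzero real numbers with $s<t$. For $(a,b)\in\mathcal{D}$, define $$\rho(s,t,p;a,b)=\frac{M_s^p(a,b)-G^p(a,b)}{M_t^p(a,b)-G^p(a,b)}.$$ (a) If $0<s<t$, then for $p\geq\max\left(2s,\frac23(s+t)\right)$ (with the exception that $p>2s$ is required if $t=2s$) we have $$\forall (a,b)\in\mathcal{D},\qquad 2^{\frac{p}{t}-\frac{p}{s}}<\rho(s,t,p;a,b)<\frac{s}{t},$$ and for $p\leq\min\left(2s,\frac23(s+t)\right)$ (with the exception that $p<2s$ is required if $t=2s$) we have $$\forall (a,b)\in\mathcal{D},\qquad \frac{s}{t}<\rho(s,t,p;a,b)<\min\left(1,2^{\frac{p}{t}-\frac{p}{s}}\right).$$ (b) If $s<t<0$, then for $p\geq\max\left(2t,\frac23(s+t)\right)$ (with the exception that $p>2t$ is required if $s=2t$) we have $$\forall (a,b)\in\mathcal{D},\qquad \max\left(1,2^{\frac{p}{t}-\frac{p}{s}}\right)<\rho(s,t,p;a,b)<\frac{s}{t},$$ and for $p\leq\min\left(2t,\frac23(s+t)\right)$ (with the exception that $p<2t$ is required if $s=2t$) we have $$\forall (a,b)\in\mathcal{D},\qquad \frac{s}{t}<\rho(s,t,p;a,b)<2^{\frac{p}{t}-\frac{p}{s}}.$$ (c) If $s<0<t$, then for $p\geq\max\left(0,\frac23(s+t)\right)$ (with the exception that $p>0$ is required if $s=-t$) we have $$\forall (a,b)\in\mathcal{D},\qquad \frac{s}{t}<\rho(s,t,p;a,b)<0,$$ and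 for $p\leq\min\left(0,\frac23(s+t)\right)$ (with the exception that $p<0$ is required if $s=-t$) we have $$\forall (a,b)\in\mathcal{D},\qquad -\infty<\rho(s,t,p;a,b)<\frac{s}{t}.$$ Moreover, all these inequalities are sharp: in each case (for each fixed admissible $s,t,p$) the stated lower and upper bounds are respectively the infimum and the supremum of $\rho(s,t,p;a,b)$ over $(a,b)\in\mathcal{D}$.
   Context: $\mathcal{D}$ denotes the set of pairs $(a,b)$ of positive real numbers with $a\neq b$. For positive reals $a,b$, $G(a,b)=\sqrt{ab}$ is the geometric mean, and for a nonzero real $r$, $M_r(a,b)=\left(\frac{a^r+b^r}{2}\right)^{1/r}$ is the power mean of order $r$. The notation $M_r^p(a,b)$ means $(M_r(a,b))^p$, and $G^p(a,b)$ means $(G(a,b))^p$. *)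

theory Defs
  imports Complex_Main "HOL-Library.Extended_Real"
begin

definition pos_pairs :: "(real \<times> real) set" ("\<D>") where
  "\<D> = {(a, b). a > 0 \<and> b > 0 \<and> a \<noteq> b}"

definition geom_mean :: "real \<Rightarrow> real \<Rightarrow> real" where
  "geom_mean a b = sqrt (a * b)"

text \<open>Only used for \<open>r \<noteq> 0\<close>; the value at \<open>r = 0\<close> is not meaningful.\<close>

definition power_mean :: "real \<Rightarrow> real \<Rightarrow> real \<Rightarrow> real" where
  "power_mean r a b = ((a powr r + b powr r) / 2) powr (1 / r)"

definition rho :: "real \<Rightarrow> real \<Rightarrow> real \<Rightarrow> real \<Rightarrow> real \<Rightarrow> real" where
  "rho s t p a b =
     (power_mean s a b powr p - geom_mean a b powr p) /
     (power_mean t a b powr p - geom_mean a b powr p)"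

text \<open>Infimum and supremum are taken in the extended reals, since \<open>rho\<close> can be
  unbounded below on \<open>\<D>\<close>.\<close>

definition rho_inf :: "real \<Rightarrow> real \<Rightarrow> real \<Rightarrow> ereal" where
  "rho_inf s t p = (INF (a, b)\<in>\<D>. ereal (rho s t p a b))"

definition rho_sup :: "real \<Rightarrow> real \<Rightarrow> real \<Rightarrow> ereal" where
  "rho_sup s t p = (SUP (a, b)\<in>\<D>. ereal (rho s t p a b))"

end

theory Submission
  imports Defs "HOL-Real_Asymp.Real_Asymp"
begin

text \<open>Writing \<open>a = g e\<^sup>x\<close>, \<open>b = g e\<^sup>-\<^sup>x\<close> turns \<open>\<rho>\<close> into
  \<open>(cosh(sx)\<^bsup>p/s\<^esup> - 1) / (cosh(tx)\<^bsup>p/t\<^esup> - 1)\<close>, an even function of \<open>x \<noteq> 0\<close>. Both terms vanish at \<open>x = 0\<close>, so by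
  the monotone form of l'Hospital's rule the quotient is strictly monotone on \<open>x > 0\<close> as soon as the
  quotient of the derivatives is; the bounds, and their sharpness, are then the limits at \<open>0\<close> and
  \<open>\<infinity>\<close>. With \<open>S = 2sx\<close>, \<open>T = 2tx\<close>, the derivative of the latter quotient has the sign of
  \<open>2(s sinh T - t sinh S) - p(sinh T - sinh S - sinh(T - S))\<close>. For \<open>p = 2s\<close> the sign is settled by the
  monotonicity of \<open>sinh y / y\<close>, and for \<open>p = 2(s+t)/3\<close> by the positivity of
  \<open>(b - a) sinh(a + b) + (a + 2b) sinh a - (2a + b) sinh b\<close> for \<open>0 < a < b\<close>. The remaining
  sign patterns follow from \<open>\<rho>(-s,-t,-p) = 1/\<rho>(t,s,p)\<close>.\<close>

section \<open>Inequalities for hyperbolic functions\<close>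

lemma pos_if_deriv_pos:
  fixes f f' :: "real \<Rightarrow> real"
  assumes "f 0 = 0" and "\<And>x. (f has_real_derivative f' x) (at x)"
    and "\<And>x. 0 < x \<Longrightarrow> 0 < f' x" and "0 < x"
  shows "0 < f x"
proof -
  obtain z where "0 < z" "z < x" "f x - f 0 = (x - 0) * f' z"
    using MVT2[of 0 x f f'] assms by auto
  with assms show ?thesis by simp
qed

lemma sinh_less_mult_cosh:
  fixes x :: real
  assumes "0 < x"
  shows "sinh x < x * cosh x"
proof -
  have "0 < x * cosh x - sinh x"
    by (rule pos_if_deriv_pos[of "\<lambda>x. x * cosh x - sinh x" "\<lambda>x. x * sinh x"])
       (use assms in \<open>auto intro!: derivative_eq_intros\<close>)
  then show ?thesis by simp
qed

text \<open>The hyperbolic Cusa-Huygens inequality. Two differentiations reduce it to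
  \<open>x * cosh x - sinh x\<close>, which is positive.\<close>

lemma sinh_less_cusa:
  fixes x :: real
  assumes "0 < x"
  shows "3 * sinh x < x * (2 + cosh x)"
proof -
  have pos: "0 < y \<Longrightarrow> 0 < 2 - 2 * cosh y + y * sinh y" for y :: real
    by (rule pos_if_deriv_pos[of "\<lambda>x. 2 - 2 * cosh x + x * sinh x" "\<lambda>x. x * cosh x - sinh x"])
       (auto intro!: derivative_eq_intros simp: sinh_less_mult_cosh)
  have "0 < x * (2 + cosh x) - 3 * sinh x"
  proof (rule pos_if_deriv_pos[of "\<lambda>x. x * (2 + cosh x) - 3 * sinh x"
          "\<lambda>x. 2 - 2 * cosh x + x * sinh x"])
    show "((\<lambda>x. x * (2 + cosh x) - 3 * sinh x) has_real_derivative
        2 - 2 * cosh y + y * sinh y) (at y)" for y :: real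
      by (auto intro!: derivative_eq_intros)
  qed (use \<open>0 < x\<close> pos in simp_all)
  then show ?thesis by simp
qed

lemma sinh_ratio_less:
  fixes a b :: real
  assumes "0 < a" "a < b"
  shows "b * sinh a < a * sinh b"
proof -
  have "sinh a / a < sinh b / b"
  proof (rule DERIV_pos_imp_increasing[OF \<open>a < b\<close>])
    fix x assume "a \<le> x" "x \<le> b"
    then have "0 < x" using assms by simp
    then show "\<exists>y. ((\<lambda>x. sinh x / x) has_real_derivative y) (at x) \<and> 0 < y"
      by (intro exI[of _ "(x * cosh x - sinh x) / x\<^sup>2"])
         (auto intro!: derivative_eq_intros simp: sinh_less_mult_cosh power2_eq_square mult_ac)
  qed
  with assms show ?thesis by (simp add: field_simps)
qed

text \<open>\<open>tanh x / x\<close> is decreasing: the sign of its derivative comes down to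
  \<open>2 * x < sinh (2 * x)\<close>.\<close>

lemma tanh_ratio_less:
  fixes a b :: real
  assumes "0 < a" "a < b"
  shows "a * tanh b < b * tanh a"
proof -
  have "tanh b / b < tanh a / a"
  proof (rule DERIV_neg_imp_decreasing[OF \<open>a < b\<close>])
    fix x assume "a \<le> x" "x \<le> b"
    then have x: "0 < x" using assms by simp
    have pos: "0 < y \<Longrightarrow> 0 < cosh y - 1" for y :: real
      using cosh_real_nonneg_less_iff[of 0 y] by simp
    have "0 < sinh (2 * x) - 2 * x"
      by (rule pos_if_deriv_pos[of "\<lambda>x. sinh x - x" "\<lambda>x. cosh x - 1"])
         (use x pos in \<open>auto intro!: derivative_eq_intros\<close>)
    then have "x < sinh x * cosh x" by (simp add: sinh_double)
    then have "x / (cosh x)\<^sup>2 < sinh x * cosh x / (cosh x)\<^sup>2"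
      by (intro divide_strict_right_mono) auto
    moreover have "1 - (tanh x)\<^sup>2 = 1 / (cosh x)\<^sup>2"
      by (simp add: tanh_def power_divide sinh_square_eq diff_divide_distrib)
    ultimately have "x * (1 - (tanh x)\<^sup>2) < tanh x"
      by (simp add: tanh_def power2_eq_square)
    then show "\<exists>y. ((\<lambda>x. tanh x / x) has_real_derivative y) (at x) \<and> y < 0"
      using x by (intro exI[of _ "(x * (1 - (tanh x)\<^sup>2) - tanh x) / x\<^sup>2"])
         (auto intro!: derivative_eq_intros simp: divide_neg_pos power2_eq_square mult.commute)
  qed
  with assms show ?thesis by (simp add: field_simps)
qed


text \<open>With \<open>u\<close> fixed, the expression vanishes at \<open>v = u\<close> and is
  strictly decreasing in \<open>v\<close> up to there.\<close>

lemma sinh_cosh_tanh_pos: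
  fixes u v :: real
  assumes "0 < v" "v < u"
  shows "0 < 2 * sinh u - 3 * u * (sinh v / v) + tanh u * cosh v"
proof -
  define g where "g = (\<lambda>w. 2 * sinh u - 3 * u * (sinh w / w) + tanh u * cosh w)"
  have "g u < g v"
  proof (rule DERIV_neg_imp_decreasing[OF \<open>v < u\<close>])
    fix w assume "v \<le> w" "w \<le> u"
    then have w: "0 < w" using assms by simp
    have u: "0 < u" using assms by simp
    \<comment> \<open>Bounding \<open>tanh u / u\<close> by \<open>tanh w / w\<close> removes
      \<open>u\<close> from the derivative condition, apart from a common factor.\<close>
    have "w * tanh u \<le> u * tanh w"
      using tanh_ratio_less[OF w, of u] \<open>w \<le> u\<close> by (cases "w = u") auto
    then have "w * tanh u * (w * sinh w) \<le> u * tanh w * (w * sinh w)"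
      by (rule mult_right_mono) (use w in simp)
    also have "\<dots> = u * (w * (sinh w)\<^sup>2 / cosh w)"
      by (simp add: tanh_def power2_eq_square)
    also have "\<dots> < u * (3 * (w * cosh w - sinh w))"
    proof -
      \<comment> \<open>Expanded by the double-angle formulas, the Cusa-Huygens inequality at
        \<open>2 * w\<close> is exactly the remaining one-variable claim.\<close>
      have "3 * sinh (2 * w) < 2 * w * (2 + cosh (2 * w))"
        using sinh_less_cusa[of "2 * w"] w by simp
      then have "w * (sinh w)\<^sup>2 < 3 * (w * cosh w - sinh w) * cosh w"
        using arg_cong[OF cosh_square_eq[of w], of "(*) w"] unfolding sinh_double cosh_double
        by (simp add: algebra_simps power2_eq_square)
      then have "w * (sinh w)\<^sup>2 / cosh w < 3 * (w * cosh w - sinh w)"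
        by (simp add: pos_divide_less_eq)
      then show ?thesis using u by (rule mult_strict_left_mono)
    qed
    finally have "tanh u * sinh w * w\<^sup>2 < 3 * u * (w * cosh w - sinh w)"
      by (simp add: power2_eq_square algebra_simps)
    then have "- (3 * u * ((w * cosh w - sinh w) / w\<^sup>2)) + tanh u * sinh w < 0"
      using w by (simp add: pos_less_divide_eq)
    then show "\<exists>y. (g has_real_derivative y) (at w) \<and> y < 0"
      using w unfolding g_def
      by (intro exI[of _ "- (3 * u * ((w * cosh w - sinh w) / w\<^sup>2)) + tanh u * sinh w"])
         (auto intro!: derivative_eq_intros simp: power2_eq_square algebra_simps)
  qed
  moreover have "g u = 0"
    using assms by (simp add: g_def tanh_def)
  ultimately show ?thesis by (simp add: g_def)
qed

text \<open>In terms of the half sum \<open>u\<close> and half difference \<open>v\<close>, the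
  combination factors as \<open>2 * v * cosh u\<close> times the expression of
  \<open>sinh_cosh_tanh_pos\<close>.\<close>

lemma sinh_combination_pos:
  fixes a b :: real
  assumes "0 < a" "a < b"
  shows "0 < (b - a) * sinh (a + b) + (a + 2 * b) * sinh a - (2 * a + b) * sinh b"
proof -
  define u v where "u = (a + b) / 2" and "v = (b - a) / 2"
  have ab: "a = u - v" "b = u + v" and v: "0 < v" "v < u"
    using assms by (simp_all add: u_def v_def field_simps)
  have "0 < 2 * v * cosh u * (2 * sinh u - 3 * u * (sinh v / v) + tanh u * cosh v)"
    using sinh_cosh_tanh_pos[OF v] v by simp
  also have "\<dots> = 2 * v * sinh (2 * u) - 6 * u * cosh u * sinh v + 2 * v * sinh u * cosh v"
    using v unfolding sinh_double by (simp add: tanh_def field_simps)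
  also have "\<dots> = (b - a) * sinh (a + b) + (a + 2 * b) * sinh a - (2 * a + b) * sinh b"
    by (simp add: ab sinh_add sinh_diff algebra_simps sinh_double)
  finally show ?thesis .
qed

lemma sinh_add_less:
  fixes a b :: real
  assumes "0 < a" "0 < b"
  shows "sinh a + sinh b < sinh (a + b)"
proof -
  have "1 < cosh a" "1 < cosh b"
    using assms cosh_real_nonneg_less_iff[of 0] by simp_all
  then have "sinh a * 1 < sinh a * cosh b" "1 * sinh b < cosh a * sinh b"
    using assms by (intro mult_strict_left_mono mult_strict_right_mono; simp)+
  then show ?thesis by (simp add: sinh_add)
qed

section \<open>Sign of the slope\<close>

text \<open>With \<open>S = 2sx\<close>, \<open>T = 2tx\<close>, \<open>P = 2px\<close> this is a positive multiple of the derivative at \<open>x\<close> of the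
  quotient of the derivatives of \<open>cosh (s x) powr (p / s)\<close> and \<open>cosh (t x) powr (p / t)\<close>.\<close>

definition slope_sign :: "real \<Rightarrow> real \<Rightarrow> real \<Rightarrow> real" where
  "slope_sign S T P = 2 * (S * sinh T - T * sinh S) - P * (sinh T - sinh S - sinh (T - S))"

text \<open>The two decompositions isolate the thresholds \<open>P = 2S\<close> and \<open>P = 2/3 (S + T)\<close>.\<close>

lemma slope_sign_split:
  "slope_sign S T P = 2 * (S * sinh (T - S) - (T - S) * sinh S)
     - (P - 2 * S) * (sinh T - sinh S - sinh (T - S))"
  "3 * slope_sign S T P = - 2 * ((T - 2 * S) * sinh T + (2 * T - S) * sinh S - (S + T) * sinh (T - S))
     - (3 * P - 2 * (S + T)) * (sinh T - sinh S - sinh (T - S))"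
  by (simp_all add: slope_sign_def algebra_simps)

text \<open>Comparing \<open>T\<close> with \<open>2 * S\<close> decides which threshold is the
  larger: \<open>2 * S\<close> for \<open>T < 2 * S\<close>, and \<open>2/3 * (S + T)\<close> for
  \<open>T > 2 * S\<close>. The split belonging to that threshold is used. At
  \<open>T = 2 * S\<close> the thresholds coincide and the main term vanishes, so strictness must
  come from \<open>P\<close>.\<close>

lemma slope_sign_neg:
  assumes "0 < S" "S < T" "2 * S \<le> P" "2 * (S + T) \<le> 3 * P" "T = 2 * S \<Longrightarrow> 2 * S < P"
  shows "slope_sign S T P < 0"
proof -
  have E: "0 < sinh T - sinh S - sinh (T - S)"
    using sinh_add_less[of S "T - S"] assms by simp
  consider "T < 2 * S" | "T = 2 * S" | "2 * S < T" by linarith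
  then show ?thesis
  proof cases
    case 1
    have "S * sinh (T - S) < (T - S) * sinh S"
      using sinh_ratio_less[of "T - S" S] 1 assms by simp
    moreover have "0 \<le> (P - 2 * S) * (sinh T - sinh S - sinh (T - S))"
      using assms E by simp
    ultimately show ?thesis by (simp add: slope_sign_split(1))
  next
    case 2
    have "0 < (P - 2 * S) * (sinh T - sinh S - sinh (T - S))"
      using assms E 2 by simp
    then show ?thesis using 2 by (simp add: slope_sign_split(1))
  next
    case 3
    define X where "X = (T - 2 * S) * sinh T + (2 * T - S) * sinh S - (S + T) * sinh (T - S)"
    have "0 < X"
      using sinh_combination_pos[of S "T - S"] 3 assms by (simp add: X_def algebra_simps)
    moreover have "0 \<le> (3 * P - 2 * (S + T)) * (sinh T - sinh S - sinh (T - S))"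
      using assms E by simp
    ultimately have "3 * slope_sign S T P < 0"
      unfolding slope_sign_split(2)[of S T P, folded X_def] by simp
    then show ?thesis by simp
  qed
qed

text \<open>Here the smaller threshold binds, so the two splits exchange their roles.\<close>

lemma slope_sign_pos:
  assumes "0 < S" "S < T" "P \<le> 2 * S" "3 * P \<le> 2 * (S + T)" "T = 2 * S \<Longrightarrow> P < 2 * S"
  shows "0 < slope_sign S T P"
proof -
  have E: "0 < sinh T - sinh S - sinh (T - S)"
    using sinh_add_less[of S "T - S"] assms by simp
  consider "T < 2 * S" | "T = 2 * S" | "2 * S < T" by linarith
  then show ?thesis
  proof cases
    case 1
    define X where "X = (T - 2 * S) * sinh T + (2 * T - S) * sinh S - (S + T) * sinh (T - S)"
    have "X < 0"
      using sinh_combination_pos[of "T - S" S] 1 assms by (simp add: X_def algebra_simps)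
    moreover have "(3 * P - 2 * (S + T)) * (sinh T - sinh S - sinh (T - S)) \<le> 0"
      using assms E by (simp add: mult_nonpos_nonneg)
    ultimately have "0 < 3 * slope_sign S T P"
      unfolding slope_sign_split(2)[of S T P, folded X_def] by simp
    then show ?thesis by simp
  next
    case 2
    have "(P - 2 * S) * (sinh T - sinh S - sinh (T - S)) < 0"
      using assms E 2 by (simp add: mult_neg_pos)
    then show ?thesis using 2 by (simp add: slope_sign_split(1))
  next
    case 3
    have "(T - S) * sinh S < S * sinh (T - S)"
      using sinh_ratio_less[of S "T - S"] 3 assms by simp
    moreover have "(P - 2 * S) * (sinh T - sinh S - sinh (T - S)) \<le> 0"
      using assms E by (simp add: mult_nonpos_nonneg)
    ultimately show ?thesis by (simp add: slope_sign_split(1))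
  qed
qed

text \<open>The factor of \<open>P\<close> is now negative. For \<open>T \<le> - S\<close> the
  definition itself serves as the split, with threshold \<open>P = 0\<close>; otherwise the
  threshold is \<open>2/3 * (S + T)\<close>.\<close>

lemma slope_sign_pos_opposite:
  assumes "S < 0" "0 < T" "0 < P" "2 * (S + T) \<le> 3 * P"
  shows "0 < slope_sign S T P"
proof -
  have E: "sinh T - sinh S - sinh (T - S) < 0"
    using sinh_add_less[of "- S" T] assms by simp
  show ?thesis
  proof (cases "T \<le> - S")
    case True
    have "T * sinh S \<le> S * sinh T"
      using sinh_ratio_less[of T "- S"] True assms by (cases "T = - S") auto
    moreover have "P * (sinh T - sinh S - sinh (T - S)) < 0"
      using assms E by (simp add: mult_pos_neg)
    ultimately show ?thesis by (simp add: slope_sign_def)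
  next
    case False
    define X where "X = (T - 2 * S) * sinh T + (2 * T - S) * sinh S - (S + T) * sinh (T - S)"
    have "X < 0"
      using sinh_combination_pos[of "- S" T] False assms by (simp add: X_def algebra_simps)
    moreover have "(3 * P - 2 * (S + T)) * (sinh T - sinh S - sinh (T - S)) \<le> 0"
      using assms E by (simp add: mult_nonneg_nonpos)
    ultimately have "0 < 3 * slope_sign S T P"
      unfolding slope_sign_split(2)[of S T P, folded X_def] by simp
    then show ?thesis by simp
  qed
qed

section \<open>Monotonicity of the quotient from the quotient of derivatives\<close>

text \<open>Cauchy's mean value theorem on \<open>[0, x]\<close> and \<open>[x, y]\<close> yields
  points \<open>c < x < d\<close>. Thus \<open>f y / g y\<close> is a weighted mean of the
  derivative quotients at \<open>c\<close> and \<open>d\<close>, and the one at \<open>c\<close>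
  equals \<open>f x / g x\<close>.\<close>

lemma monotone_lhopital:
  fixes f g f' g' :: "real \<Rightarrow> real"
  assumes "f 0 = 0" "g 0 = 0"
    and f: "\<And>x. (f has_real_derivative f' x) (at x)"
    and g: "\<And>x. (g has_real_derivative g' x) (at x)"
    and g': "\<And>x. 0 < x \<Longrightarrow> 0 < g' x"
    and dec: "\<And>x y. 0 < x \<Longrightarrow> x < y \<Longrightarrow> f' y / g' y < f' x / g' x"
    and xy: "0 < x" "x < y"
  shows "f y / g y < f x / g x"
proof -
  have ratio: "\<exists>c. a < c \<and> c < b \<and> f b - f a = f' c / g' c * (g b - g a)" if "0 \<le> a" "a < b" for a b
  proof -
    obtain c where "a < c" "c < b" "(f b - f a) * g' c = (g b - g a) * f' c"
      using GMVT'[OF \<open>a < b\<close>, of f g g' f'] f g DERIV_isCont by blast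
    then show ?thesis
      using g'[of c] that by (intro exI[of _ c]) (simp add: field_simps)
  qed
  obtain c where c: "0 < c" "c < x" "f x = f' c / g' c * g x"
    using ratio[of 0 x] assms by auto
  obtain d where d: "x < d" "f y - f x = f' d / g' d * (g y - g x)"
    using ratio[of x y] xy by auto
  have "g 0 < g x" "g x < g y"
    by (rule DERIV_pos_imp_increasing_open;
        use xy g g' in \<open>force intro: DERIV_isCont continuous_at_imp_continuous_on\<close>)+
  then have gx: "0 < g x" "g x < g y" using \<open>g 0 = 0\<close> by simp_all
  have "f y = f' c / g' c * g x + f' d / g' d * (g y - g x)"
    using c d by simp
  also have "\<dots> < f' c / g' c * g x + f' c / g' c * (g y - g x)"
    using dec[of c d] c d gx by (intro add_strict_left_mono mult_strict_right_mono) auto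
  also have "\<dots> = f x / g x * g y"
  proof -
    have "f x / g x = f' c / g' c" using c(3) gx by simp
    then show ?thesis by (simp only: flip: distrib_left) simp
  qed
  finally show ?thesis
    using gx by (simp add: pos_divide_less_eq)
qed

definition cosh_ratio :: "real \<Rightarrow> real \<Rightarrow> real \<Rightarrow> real \<Rightarrow> real" where
  "cosh_ratio s t p x = (cosh (s * x) powr (p / s) - 1) / (cosh (t * x) powr (p / t) - 1)"

text \<open>The quotient of the derivatives after cancelling \<open>p\<close>. In the exponential
  form the power factors reappear unchanged under differentiation.\<close>

definition slope_ratio :: "real \<Rightarrow> real \<Rightarrow> real \<Rightarrow> real \<Rightarrow> real" where
  "slope_ratio s t p x =
     exp ((p / s - 1) * ln (cosh (s * x)) - (p / t - 1) * ln (cosh (t * x))) * (sinh (s * x) / sinh (t * x))"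

lemma slope_ratio_eq:
  "slope_ratio s t p x =
    (sinh (s * x) * cosh (s * x) powr (p / s - 1)) / (sinh (t * x) * cosh (t * x) powr (p / t - 1))"
  by (simp add: slope_ratio_def powr_def exp_diff mult.commute)

text \<open>Apart from the exponential factor and denominators, the derivative is a polynomial in
  the four hyperbolic values \<open>a\<close>, \<open>b\<close>, \<open>c\<close>, \<open>d\<close>,
  which matches \<open>slope_sign\<close> modulo
  \<open>cosh\<^sup>2 = sinh\<^sup>2 + 1\<close>.\<close>

lemma slope_ratio_deriv:
  assumes "s \<noteq> 0" "0 < t" "0 < x"
  shows "\<exists>k>0. (slope_ratio s t p has_real_derivative k * slope_sign (2 * s * x) (2 * t * x) (2 * p * x)) (at x)"
proof -
  define a b c d where "a = sinh (s * x)" and "b = cosh (s * x)" and "c = sinh (t * x)" and "d = cosh (t * x)"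
  have pos: "0 < b" "0 < c" "0 < d" using assms by (simp_all add: b_def c_def d_def)
  have pyth: "b\<^sup>2 = a\<^sup>2 + 1" "d\<^sup>2 = c\<^sup>2 + 1"
    by (simp_all add: a_def b_def c_def d_def cosh_square_eq)
  define e where "e = exp ((p / s - 1) * ln b - (p / t - 1) * ln d)"
  define D where "D = e * ((p - s) * (a / b) - (p - t) * (c / d)) * (a / c)
    + e * ((s * b * c - t * a * d) / c\<^sup>2)"
  \<comment> \<open>This is \<open>slope_sign\<close> without its factor \<open>2 * x\<close>, with
    \<open>sinh T\<close>, \<open>sinh S\<close> and \<open>sinh (T - S)\<close> expanded by the
    double-angle and subtraction formulas.\<close>
  define Z where "Z = 2 * (s * (2 * c * d) - t * (2 * a * b))
        - p * (2 * c * d - 2 * a * b - 2 * (c * b - d * a) * (d * b - c * a))"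
  have "(slope_ratio s t p has_real_derivative D) (at x)"
    unfolding slope_ratio_def[abs_def]
    using assms pos
    by (auto intro!: derivative_eq_intros
        simp: D_def e_def a_def[symmetric] b_def[symmetric] c_def[symmetric] d_def[symmetric])
       (simp add: field_simps power2_eq_square)
  moreover have "slope_sign (2 * s * x) (2 * t * x) (2 * p * x) =
      2 * x * Z"
  proof -
    have S: "2 * s * x = 2 * (s * x)" "2 * t * x = 2 * (t * x)" "2 * p * x = 2 * (p * x)" by simp_all
    have "2 * (t * x) - 2 * (s * x) = 2 * (t * x - s * x)" by simp
    then show ?thesis
      unfolding slope_sign_def S
      by (simp only: sinh_double sinh_diff cosh_diff Z_def a_def b_def c_def d_def) (simp add: algebra_simps)
  qed
  moreover have "D * (4 * b * d * c\<^sup>2) = e * Z"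
  proof -
    have "D * (4 * b * d * c\<^sup>2) = e * (4 * ((p - s) * (a\<^sup>2 * c * d) - (p - t) * (a * b * c\<^sup>2)
        + (s * b * c - t * a * d) * b * d))"
      using pos by (simp add: D_def field_simps power2_eq_square)
    also have "4 * ((p - s) * (a\<^sup>2 * c * d) - (p - t) * (a * b * c\<^sup>2) + (s * b * c - t * a * d) * b * d)
       = 2 * (s * (2 * c * d) - t * (2 * a * b))
        - p * (2 * c * d - 2 * a * b - 2 * (c * b - d * a) * (d * b - c * a))"
      using pyth by algebra
    finally show ?thesis unfolding Z_def .
  qed
  ultimately have "D = e / (8 * x * b * d * c\<^sup>2) * slope_sign (2 * s * x) (2 * t * x) (2 * p * x)"
    using pos \<open>0 < x\<close> by (simp add: field_simps)
  with \<open>(slope_ratio s t p has_real_derivative D) (at x)\<close> show ?thesis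
    using pos \<open>0 < x\<close> by (intro exI[of _ "e / (8 * x * b * d * c\<^sup>2)"]) (simp add: e_def)
qed

lemma slope_ratio_less:
  assumes "s \<noteq> 0" "0 < t" "0 < x" "x < y"
    and "\<And>z. 0 < z \<Longrightarrow> slope_sign (2 * s * z) (2 * t * z) (2 * p * z) < 0"
  shows "slope_ratio s t p y < slope_ratio s t p x"
  using \<open>x < y\<close>
proof (rule DERIV_neg_imp_decreasing)
  fix z assume "x \<le> z"
  then show "\<exists>d. (slope_ratio s t p has_real_derivative d) (at z) \<and> d < 0"
    using slope_ratio_deriv[of s t z p] assms mult_pos_neg by (metis less_le_trans)
qed

lemma slope_ratio_greater:
  assumes "s \<noteq> 0" "0 < t" "0 < x" "x < y"
    and "\<And>z. 0 < z \<Longrightarrow> 0 < slope_sign (2 * s * z) (2 * t * z) (2 * p * z)"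
  shows "slope_ratio s t p x < slope_ratio s t p y"
  using \<open>x < y\<close>
proof (rule DERIV_pos_imp_increasing)
  fix z assume "x \<le> z"
  then show "\<exists>d. (slope_ratio s t p has_real_derivative d) (at z) \<and> 0 < d"
    using slope_ratio_deriv[of s t z p] assms mult_pos_pos by (metis less_le_trans)
qed

text \<open>The common factor \<open>p\<close> of both derivatives is divided out, so that the derivative of the
  denominator is positive whatever the sign of \<open>p\<close>.\<close>

lemma cosh_powr_deriv_scaled:
  assumes "s \<noteq> 0" "p \<noteq> 0"
  shows "((\<lambda>x. (cosh (s * x) powr (p / s) - 1) / p) has_real_derivative
      sinh (s * x) * cosh (s * x) powr (p / s - 1)) (at x)"
  using assms by (auto intro!: derivative_eq_intros)

lemma cosh_ratio_decreasing:
  assumes "s \<noteq> 0" "0 < t" "p \<noteq> 0" "0 < x" "x < y"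
    and "\<And>z. 0 < z \<Longrightarrow> slope_sign (2 * s * z) (2 * t * z) (2 * p * z) < 0"
  shows "cosh_ratio s t p y < cosh_ratio s t p x"
proof -
  have "(cosh (s * y) powr (p / s) - 1) / p / ((cosh (t * y) powr (p / t) - 1) / p)
      < (cosh (s * x) powr (p / s) - 1) / p / ((cosh (t * x) powr (p / t) - 1) / p)"
    by (rule monotone_lhopital[OF _ _ cosh_powr_deriv_scaled cosh_powr_deriv_scaled])
       (use assms slope_ratio_less[of s t _ _ p] in \<open>auto simp: slope_ratio_eq\<close>)
  with \<open>p \<noteq> 0\<close> show ?thesis by (simp add: cosh_ratio_def)
qed

lemma cosh_ratio_increasing:
  assumes "s \<noteq> 0" "0 < t" "p \<noteq> 0" "0 < x" "x < y"
    and "\<And>z. 0 < z \<Longrightarrow> 0 < slope_sign (2 * s * z) (2 * t * z) (2 * p * z)"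
  shows "cosh_ratio s t p x < cosh_ratio s t p y"
proof -
  \<comment> \<open>Negating the numerator turns the decreasing version of l'Hospital's rule into
    the increasing one.\<close>
  have deriv: "((\<lambda>x. - ((cosh (s * x) powr (p / s) - 1) / p)) has_real_derivative
      - (sinh (s * x) * cosh (s * x) powr (p / s - 1))) (at x)" for x
    using assms by (intro DERIV_minus cosh_powr_deriv_scaled)
  have "- ((cosh (s * y) powr (p / s) - 1) / p) / ((cosh (t * y) powr (p / t) - 1) / p)
      < - ((cosh (s * x) powr (p / s) - 1) / p) / ((cosh (t * x) powr (p / t) - 1) / p)"
    by (rule monotone_lhopital[OF _ _ deriv cosh_powr_deriv_scaled])
       (use assms slope_ratio_greater[of s t _ _ p] in \<open>auto simp: slope_ratio_eq\<close>)
  with \<open>p \<noteq> 0\<close> show ?thesis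
    unfolding minus_divide_left[symmetric] neg_less_iff_less by (simp add: cosh_ratio_def)
qed

section \<open>Limits at zero and infinity\<close>

lemma cosh_ratio_inverse: "cosh_ratio (- s) (- t) (- p) x = inverse (cosh_ratio t s p x)"
  by (simp add: cosh_ratio_def)

text \<open>To second order, numerator and denominator are \<open>p * s * x\<^sup>2 / 2\<close> and
  \<open>p * t * x\<^sup>2 / 2\<close>.\<close>

lemma cosh_ratio_tendsto_0:
  assumes "s \<noteq> 0" "0 < t" "p \<noteq> 0"
  shows "(cosh_ratio s t p \<longlongrightarrow> s / t) (at_right 0)"
  using assms unfolding cosh_ratio_def[abs_def] by (cases "0 < s") real_asymp+

lemma cosh_powr_tendsto_0:
  fixes t c :: real
  assumes "0 < t" "c < 0"
  shows "((\<lambda>x. cosh (t * x) powr c) \<longlongrightarrow> 0) at_top"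
  using assms by real_asymp

text \<open>\<open>cosh (s * x) powr (p / s)\<close> grows like
  \<open>2 powr (- p / s) * exp (p * x)\<close>; the exponential is the same for \<open>t\<close>
  and cancels.\<close>

lemma cosh_ratio_tendsto_pos:
  assumes "0 < s" "0 < t" "0 < p"
  shows "(cosh_ratio s t p \<longlongrightarrow> 2 powr (p / t - p / s)) at_top"
proof -
  have "(cosh_ratio s t p \<longlongrightarrow> (1 / 2) powr (p / s) * inverse ((1 / 2) powr (p / t))) at_top"
    using assms unfolding cosh_ratio_def[abs_def] by real_asymp
  also have "(1 / 2) powr (p / s) * inverse ((1 / 2) powr (p / t)) = 2 powr (p / t - p / s)"
    by (simp add: powr_diff powr_divide field_simps)
  finally show ?thesis .
qed

lemma cosh_ratio_tendsto_neg:
  assumes "0 < s" "0 < t" "p < 0"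
  shows "(cosh_ratio s t p \<longlongrightarrow> 1) at_top"
proof -
  have "(cosh_ratio s t p \<longlongrightarrow> (0 - 1) / (0 - 1)) at_top"
    unfolding cosh_ratio_def[abs_def]
    using assms by (intro tendsto_intros cosh_powr_tendsto_0) (simp_all add: divide_neg_pos)
  then show ?thesis by simp
qed

text \<open>The numerator tends to -1, because \<open>p / s < 0\<close>, while the denominator tends
  to infinity.\<close>

lemma cosh_ratio_tendsto_opposite:
  assumes "s < 0" "0 < t" "0 < p"
  shows "(cosh_ratio s t p \<longlongrightarrow> 0) at_top"
proof -
  have "((\<lambda>x. cosh (- s * x) powr (p / s)) \<longlongrightarrow> 0) at_top"
    using assms by (intro cosh_powr_tendsto_0) (simp_all add: divide_pos_neg)
  then have "((\<lambda>x. cosh (s * x) powr (p / s) - 1) \<longlongrightarrow> 0 - 1) at_top"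
    by (intro tendsto_intros) simp
  moreover have "filterlim (\<lambda>x. cosh (t * x) powr (p / t) - 1) at_top at_top"
    using assms by real_asymp
  ultimately show ?thesis
    unfolding cosh_ratio_def[abs_def]
    by (intro real_tendsto_divide_at_top)
qed

section \<open>Reduction of the means to the hyperbolic quotient\<close>

lemma power_mean_eq:
  assumes "0 < a" "0 < b" "r \<noteq> 0"
  shows "power_mean r a b = geom_mean a b * cosh (r * ((ln a - ln b) / 2)) powr (1 / r)"
proof -
  define m x where "m = (ln a + ln b) / 2" and "x = (ln a - ln b) / 2"
  have ab: "a = exp (m + x)" "b = exp (m - x)"
    using assms by (simp_all add: m_def x_def diff_divide_distrib add_divide_distrib)
  have "a powr r = exp (r * m) * exp (r * x)" "b powr r = exp (r * m) * exp (- (r * x))"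
    unfolding ab exp_powr_real by (simp_all add: algebra_simps flip: exp_add)
  then have "(a powr r + b powr r) / 2 = exp (r * m) * cosh (r * x)"
    by (simp add: cosh_field_def algebra_simps)
  moreover have "geom_mean a b = exp m"
    by (simp add: ab geom_mean_def flip: exp_add) (rule real_sqrt_unique; simp flip: exp_double)
  ultimately show ?thesis
    using assms by (simp add: power_mean_def powr_mult exp_powr_real x_def)
qed

lemma rho_eq_cosh_ratio:
  assumes "0 < a" "0 < b" "s \<noteq> 0" "t \<noteq> 0"
  shows "rho s t p a b = cosh_ratio s t p ((ln a - ln b) / 2)"
proof -
  have G: "0 < geom_mean a b" using assms by (simp add: geom_mean_def)
  have "power_mean r a b powr p - geom_mean a b powr p =
      geom_mean a b powr p * (cosh (r * ((ln a - ln b) / 2)) powr (p / r) - 1)" if "r \<noteq> 0" for r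
    using assms that G by (simp add: power_mean_eq powr_mult powr_powr algebra_simps)
  then show ?thesis
    using assms G by (simp add: rho_def cosh_ratio_def)
qed

text \<open>The quotient is even in \<open>x\<close>, and each \<open>x > 0\<close> arises from the
  pair \<open>exp x\<close>, \<open>exp (- x)\<close>. Equality of images transfers bounds, infimum
  and supremum at once.\<close>

lemma rho_image:
  assumes "s \<noteq> 0" "t \<noteq> 0"
  shows "(\<lambda>(a, b). rho s t p a b) ` \<D> = cosh_ratio s t p ` {0<..}"
proof (intro subset_antisym subsetI)
  fix y assume "y \<in> (\<lambda>(a, b). rho s t p a b) ` \<D>"
  then obtain a b where ab: "0 < a" "0 < b" "a \<noteq> b" "y = rho s t p a b"
    by (auto simp: pos_pairs_def)
  have "y = cosh_ratio s t p (\<bar>(ln a - ln b) / 2\<bar>)"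
    using ab assms by (simp add: rho_eq_cosh_ratio cosh_ratio_def abs_if)
  then show "y \<in> cosh_ratio s t p ` {0<..}"
    using ab by (intro image_eqI[of _ _ "\<bar>(ln a - ln b) / 2\<bar>"]) auto
next
  fix y assume "y \<in> cosh_ratio s t p ` {0<..}"
  then obtain x where x: "0 < x" "y = cosh_ratio s t p x" by auto
  then have "y = rho s t p (exp x) (exp (- x))"
    using assms by (simp add: rho_eq_cosh_ratio)
  then show "y \<in> (\<lambda>(a, b). rho s t p a b) ` \<D>"
    using x by (intro image_eqI[of _ _ "(exp x, exp (- x))"]) (auto simp: pos_pairs_def)
qed

lemma rho_inf_eq: "s \<noteq> 0 \<Longrightarrow> t \<noteq> 0 \<Longrightarrow> rho_inf s t p = (INF x\<in>{0<..}. ereal (cosh_ratio s t p x))"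
  using arg_cong[OF rho_image[of s t p], of "\<lambda>A. Inf (ereal ` A)"]
  by (simp add: rho_inf_def image_image case_prod_unfold)

lemma rho_sup_eq: "s \<noteq> 0 \<Longrightarrow> t \<noteq> 0 \<Longrightarrow> rho_sup s t p = (SUP x\<in>{0<..}. ereal (cosh_ratio s t p x))"
  using arg_cong[OF rho_image[of s t p], of "\<lambda>A. Sup (ereal ` A)"]
  by (simp add: rho_sup_def image_image case_prod_unfold)

section \<open>Bounds, infimum and supremum of monotone functions\<close>

text \<open>The order-topological generality covers \<open>ereal\<close>, where the limit at
  infinity may be infinite.\<close>

lemma decreasing_range:
  fixes h :: "real \<Rightarrow> 'a :: {complete_linorder, linorder_topology}"
  assumes dec: "\<And>x y. 0 < x \<Longrightarrow> x < y \<Longrightarrow> h y < h x"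
    and lim0: "(h \<longlongrightarrow> U) (at_right 0)" and liminf: "(h \<longlongrightarrow> L) at_top"
  shows "0 < x \<Longrightarrow> L < h x \<and> h x < U" and "(INF x\<in>{0<..}. h x) = L" and "(SUP x\<in>{0<..}. h x) = U"
proof -
  have L: "L < h x" if "0 < x" for x
  proof -
    \<comment> \<open>Limits only give weak bounds; passing through the intermediate point
      \<open>x + 1\<close> makes the bound strict. The point \<open>x / 2\<close> does the same for
      \<open>U\<close>.\<close>
    have "\<forall>\<^sub>F y in at_top. h y \<le> h (x + 1)"
      using eventually_gt_at_top[of "x + 1"] by eventually_elim (use that in \<open>auto intro!: less_imp_le dec\<close>)
    then have "L \<le> h (x + 1)"
      by (rule tendsto_upperbound[OF liminf]) simp
    also have "\<dots> < h x" using that by (intro dec) auto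
    finally show ?thesis .
  qed
  moreover have U: "h x < U" if "0 < x" for x
  proof -
    have "\<forall>\<^sub>F y in at_right 0. h (x / 2) \<le> h y"
      using eventually_at_right_real[of 0 "x / 2"] that by (auto elim!: eventually_mono intro!: less_imp_le dec)
    then have "h (x / 2) \<le> U"
      by (rule tendsto_lowerbound[OF lim0]) simp
    moreover have "h x < h (x / 2)" using that by (intro dec) auto
    ultimately show ?thesis by simp
  qed
  ultimately show "0 < x \<Longrightarrow> L < h x \<and> h x < U" by blast
  have "\<forall>\<^sub>F y in at_top. (INF x\<in>{0<..}. h x) \<le> h y"
    using eventually_gt_at_top[of 0] by eventually_elim (auto intro: INF_lower)
  then have "(INF x\<in>{0<..}. h x) \<le> L"
    by (rule tendsto_lowerbound[OF liminf]) simp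
  then show "(INF x\<in>{0<..}. h x) = L"
    using L by (intro antisym INF_greatest) (auto intro: less_imp_le)
  have "\<forall>\<^sub>F y in at_right 0. h y \<le> (SUP x\<in>{0<..}. h x)"
    using eventually_at_right_real[of 0 1] by (auto elim!: eventually_mono intro: SUP_upper)
  then have "U \<le> (SUP x\<in>{0<..}. h x)"
    by (rule tendsto_upperbound[OF lim0]) simp
  then show "(SUP x\<in>{0<..}. h x) = U"
    using U by (intro antisym SUP_least) (auto intro: less_imp_le)
qed

text \<open>The substitution of \<open>inverse x\<close> for \<open>x\<close> exchanges the two ends
  of the half-line and makes \<open>h\<close> decreasing.\<close>

lemma increasing_range:
  fixes h :: "real \<Rightarrow> 'a :: {complete_linorder, linorder_topology}"
  assumes inc: "\<And>x y. 0 < x \<Longrightarrow> x < y \<Longrightarrow> h x < h y"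
    and lim0: "(h \<longlongrightarrow> L) (at_right 0)" and liminf: "(h \<longlongrightarrow> U) at_top"
  shows "0 < x \<Longrightarrow> L < h x \<and> h x < U" and "(INF x\<in>{0<..}. h x) = L" and "(SUP x\<in>{0<..}. h x) = U"
proof -
  have img: "h ` {0<..} = (\<lambda>x. h (inverse x)) ` {0<..}"
    by (auto simp: image_iff intro!: bexI[of _ "inverse x" for x])
  have dec: "h (inverse y) < h (inverse x)" if "0 < x" "x < y" for x y
    using that by (intro inc less_imp_inverse_less) auto
  have lim0': "((\<lambda>x. h (inverse x)) \<longlongrightarrow> U) (at_right 0)"
    by (rule filterlim_compose[OF liminf filterlim_inverse_at_top_right])
  have liminf': "((\<lambda>x. h (inverse x)) \<longlongrightarrow> L) at_top"
    by (rule filterlim_compose[OF lim0 filterlim_inverse_at_right_top])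
  note range = decreasing_range[of "\<lambda>x. h (inverse x)", OF dec lim0' liminf']
  show "0 < x \<Longrightarrow> L < h x \<and> h x < U" using range(1)[of "inverse x"] by simp
  show "(INF x\<in>{0<..}. h x) = L" "(SUP x\<in>{0<..}. h x) = U"
    using range(2,3) by (simp_all add: img)
qed

text \<open>The lower end \<open>L\<close> is extended real because the quotient is unbounded below
  in one case with \<open>s < 0 < t\<close>.\<close>

lemma rho_decreasing_range:
  assumes "s \<noteq> 0" "t \<noteq> 0"
    and dec: "\<And>x y. 0 < x \<Longrightarrow> x < y \<Longrightarrow> cosh_ratio s t p y < cosh_ratio s t p x"
    and lim: "(cosh_ratio s t p \<longlongrightarrow> u) (at_right 0)" "((\<lambda>x. ereal (cosh_ratio s t p x)) \<longlongrightarrow> L) at_top"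
  shows "(\<forall>(a, b)\<in>\<D>. L < ereal (rho s t p a b) \<and> rho s t p a b < u) \<and>
    rho_inf s t p = L \<and> rho_sup s t p = ereal u"
proof -
  note range = decreasing_range[of "\<lambda>x. ereal (cosh_ratio s t p x)", OF _ tendsto_ereal[OF lim(1)] lim(2)]
  have "\<forall>y \<in> cosh_ratio s t p ` {0<..}. L < ereal y \<and> y < u"
    using range(1) dec by auto
  then have "\<forall>y \<in> (\<lambda>(a, b). rho s t p a b) ` \<D>. L < ereal y \<and> y < u"
    using assms by (simp add: rho_image)
  with range(2,3) dec show ?thesis
    using assms by (auto simp: rho_inf_eq rho_sup_eq)
qed

lemma rho_increasing_range:
  assumes "s \<noteq> 0" "t \<noteq> 0"
    and inc: "\<And>x y. 0 < x \<Longrightarrow> x < y \<Longrightarrow> cosh_ratio s t p x < cosh_ratio s t p y"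
    and lim: "(cosh_ratio s t p \<longlongrightarrow> l) (at_right 0)" "(cosh_ratio s t p \<longlongrightarrow> u) at_top"
  shows "(\<forall>(a, b)\<in>\<D>. l < rho s t p a b \<and> rho s t p a b < u) \<and>
    rho_inf s t p = ereal l \<and> rho_sup s t p = ereal u"
proof -
  note range = increasing_range[of "\<lambda>x. ereal (cosh_ratio s t p x)",
      OF _ tendsto_ereal[OF lim(1)] tendsto_ereal[OF lim(2)]]
  have "\<forall>y \<in> cosh_ratio s t p ` {0<..}. l < y \<and> y < u"
    using range(1) inc by auto
  then have "\<forall>y \<in> (\<lambda>(a, b). rho s t p a b) ` \<D>. l < y \<and> y < u"
    using assms by (simp add: rho_image)
  with range(2,3) inc show ?thesis
    using assms by (auto simp: rho_inf_eq rho_sup_eq)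
qed

section \<open>Sign conditions in the original parameters, and signs of the quotient\<close>

text \<open>The conditions on \<open>s\<close>, \<open>t\<close>, \<open>p\<close> are homogeneous
  of degree one, hence survive multiplication by \<open>2 * z\<close>.\<close>

lemma slope_sign_scaled_neg:
  assumes "0 < s" "s < t" "2 * s \<le> p" "2 * (s + t) \<le> 3 * p" "t = 2 * s \<Longrightarrow> 2 * s < p" "0 < z"
  shows "slope_sign (2 * s * z) (2 * t * z) (2 * p * z) < 0"
proof (rule slope_sign_neg)
  show "2 * (2 * s * z) \<le> 2 * p * z" "2 * (2 * s * z + 2 * t * z) \<le> 3 * (2 * p * z)"
    using mult_right_mono[OF assms(3), of "2 * z"] mult_right_mono[OF assms(4), of "2 * z"] assms
    by (simp_all add: algebra_simps)
qed (use assms in auto)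

lemma slope_sign_scaled_pos:
  assumes "0 < s" "s < t" "p \<le> 2 * s" "3 * p \<le> 2 * (s + t)" "t = 2 * s \<Longrightarrow> p < 2 * s" "0 < z"
  shows "0 < slope_sign (2 * s * z) (2 * t * z) (2 * p * z)"
proof (rule slope_sign_pos)
  show "2 * p * z \<le> 2 * (2 * s * z)" "3 * (2 * p * z) \<le> 2 * (2 * s * z + 2 * t * z)"
    using mult_right_mono[OF assms(3), of "2 * z"] mult_right_mono[OF assms(4), of "2 * z"] assms
    by (simp_all add: algebra_simps)
qed (use assms in auto)

lemma slope_sign_scaled_pos_opposite:
  assumes "s < 0" "0 < t" "0 < p" "2 * (s + t) \<le> 3 * p" "0 < z"
  shows "0 < slope_sign (2 * s * z) (2 * t * z) (2 * p * z)"
proof (rule slope_sign_pos_opposite)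
  show "2 * (2 * s * z + 2 * t * z) \<le> 3 * (2 * p * z)"
    using mult_right_mono[OF assms(4), of "2 * z"] assms by (simp add: algebra_simps)
qed (use assms in \<open>auto simp: mult_neg_pos\<close>)

lemma cosh_powr_cases:
  fixes s x c :: real
  assumes "s \<noteq> 0" "0 < x"
  shows "0 < c \<Longrightarrow> 1 < cosh (s * x) powr c" "c < 0 \<Longrightarrow> cosh (s * x) powr c < 1"
proof -
  have "1 < cosh (s * x)"
    using assms cosh_real_ge_1[of "s * x"] by (simp add: order_less_le eq_commute[of 1])
  then show "0 < c \<Longrightarrow> 1 < cosh (s * x) powr c" "c < 0 \<Longrightarrow> cosh (s * x) powr c < 1"
    by (simp_all add: powr_less_one)
qed

text \<open>Numerator and denominator both have the sign of \<open>p\<close>. A fixed sign of the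
  quotient is what makes taking reciprocals reverse the order.\<close>

lemma cosh_ratio_pos:
  assumes "0 < s" "0 < t" "p \<noteq> 0" "0 < x"
  shows "0 < cosh_ratio s t p x"
proof (cases "0 < p")
  case True
  then show ?thesis using assms by (simp add: cosh_ratio_def cosh_powr_cases)
next
  case False
  with assms have "p / s < 0" "p / t < 0" by (auto intro: divide_neg_pos)
  with assms show ?thesis
    by (simp add: cosh_ratio_def cosh_powr_cases divide_neg_neg)
qed

lemma cosh_ratio_neg:
  assumes "s < 0" "0 < t" "0 < p" "0 < x"
  shows "cosh_ratio s t p x < 0"
proof -
  have "p / s < 0" "0 < p / t" using assms by (simp_all add: divide_pos_neg)
  with assms show ?thesis
    by (simp add: cosh_ratio_def cosh_powr_cases divide_neg_pos)
qed

text \<open>The limit is the power of 2 for \<open>p > 0\<close> and 1 for \<open>p < 0\<close>;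
  since \<open>s < t\<close>, it is the smaller of the two numbers either way.\<close>

lemma cosh_ratio_tendsto_same_sign:
  assumes "0 < s" "s < t" "p \<noteq> 0"
  shows "(cosh_ratio s t p \<longlongrightarrow> min 1 (2 powr (p / t - p / s))) at_top"
proof (cases "0 < p")
  case True
  with assms have "p / t < p / s" by (simp add: divide_strict_left_mono)
  then have "(2 :: real) powr (p / t - p / s) < 2 powr 0"
    by (intro powr_less_mono) auto
  with True assms show ?thesis
    using cosh_ratio_tendsto_pos[of s t p] by (simp add: min_def)
next
  case False
  with assms have "p / s < p / t" by (simp add: divide_strict_left_mono_neg)
  then have "(2 :: real) powr 0 < 2 powr (p / t - p / s)"
    by (intro powr_less_mono) auto
  with False assms show ?thesis
    using cosh_ratio_tendsto_neg[of s t p] by (simp add: min_def)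
qed

theorem theorem3p1:
  fixes s t p :: real
  assumes "s \<noteq> 0" and "t \<noteq> 0" and "p \<noteq> 0" and "s < t"
  shows
    "(0 < s \<longrightarrow>
       (p \<ge> max (2 * s) (2 / 3 * (s + t)) \<and> (t = 2 * s \<longrightarrow> p > 2 * s) \<longrightarrow>
          (\<forall>(a, b)\<in>\<D>. 2 powr (p / t - p / s) < rho s t p a b \<and> rho s t p a b < s / t) \<and>
          rho_inf s t p = ereal (2 powr (p / t - p / s)) \<and>
          rho_sup s t p = ereal (s / t)) \<and>
       (p \<le> min (2 * s) (2 / 3 * (s + t)) \<and> (t = 2 * s \<longrightarrow> p < 2 * s) \<longrightarrow>
          (\<forall>(a, b)\<in>\<D>. s / t < rho s t p a b \<and> rho s t p a b < min 1 (2 powr (p / t - p / s))) \<and>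
          rho_inf s t p = ereal (s / t) \<and>
          rho_sup s t p = ereal (min 1 (2 powr (p / t - p / s))))) \<and>
     (t < 0 \<longrightarrow>
       (p \<ge> max (2 * t) (2 / 3 * (s + t)) \<and> (s = 2 * t \<longrightarrow> p > 2 * t) \<longrightarrow>
          (\<forall>(a, b)\<in>\<D>. max 1 (2 powr (p / t - p / s)) < rho s t p a b \<and> rho s t p a b < s / t) \<and>
          rho_inf s t p = ereal (max 1 (2 powr (p / t - p / s))) \<and>
          rho_sup s t p = ereal (s / t)) \<and>
       (p \<le> min (2 * t) (2 / 3 * (s + t)) \<and> (s = 2 * t \<longrightarrow> p < 2 * t) \<longrightarrow>
          (\<forall>(a, b)\<in>\<D>. s / t < rho s t p a b \<and> rho s t p a b < 2 powr (p / t - p / s)) \<and>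
          rho_inf s t p = ereal (s / t) \<and>
          rho_sup s t p = ereal (2 powr (p / t - p / s)))) \<and>
     (s < 0 \<and> 0 < t \<longrightarrow>
       (p \<ge> max 0 (2 / 3 * (s + t)) \<and> (s = - t \<longrightarrow> p > 0) \<longrightarrow>
          (\<forall>(a, b)\<in>\<D>. s / t < rho s t p a b \<and> rho s t p a b < 0) \<and>
          rho_inf s t p = ereal (s / t) \<and>
          rho_sup s t p = ereal 0) \<and>
       (p \<le> min 0 (2 / 3 * (s + t)) \<and> (s = - t \<longrightarrow> p < 0) \<longrightarrow>
          (\<forall>(a, b)\<in>\<D>. - \<infinity> < ereal (rho s t p a b) \<and> rho s t p a b < s / t) \<and>
          rho_inf s t p = - \<infinity> \<and>
          rho_sup s t p = ereal (s / t)))"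
proof -
  \<comment> \<open>The monotonicity lemmas need a positive second parameter. Passing to
    \<open>- t\<close>, \<open>- s\<close>, \<open>- p\<close> provides one when
    \<open>s < 0\<close> and keeps the first parameter below the second.\<close>
  have inverse_eq: "cosh_ratio s t p = (\<lambda>x. inverse (cosh_ratio (- t) (- s) (- p) x))"
    by (rule ext) (simp add: cosh_ratio_inverse[of t s p, symmetric] cosh_ratio_def)
  have lim0_inverse: "(cosh_ratio s t p \<longlongrightarrow> s / t) (at_right 0)" if "s < 0"
    using tendsto_inverse[OF cosh_ratio_tendsto_0[of "- t" "- s" "- p"]] that assms
    by (simp add: inverse_eq)
  have inverse_powr: "inverse (2 powr (p / s - p / t)) = 2 powr (p / t - p / s)"
    by (simp flip: powr_minus)
  show ?thesis
  \<comment> \<open>The instantiation splits only conjunctions that begin with an implication, so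
    each of the six cases keeps its bounds, infimum and supremum in one goal.\<close>
  proof (intro conjI[where P = "A \<longrightarrow> B" for A B] impI, goal_cases)
    case 1
    then have sp: "0 < s" "0 < t" "0 < p" using assms by auto
    have "cosh_ratio s t p y < cosh_ratio s t p x" if "0 < x" "x < y" for x y
      using 1 assms sp that by (intro cosh_ratio_decreasing slope_sign_scaled_neg) auto
    from rho_decreasing_range[OF _ _ this cosh_ratio_tendsto_0 tendsto_ereal[OF cosh_ratio_tendsto_pos]]
    show ?case using sp by simp
  next
    case 2
    then have sp: "0 < s" "0 < t" using assms by auto
    have "cosh_ratio s t p x < cosh_ratio s t p y" if "0 < x" "x < y" for x y
      using 2 assms sp that by (intro cosh_ratio_increasing slope_sign_scaled_pos) auto
    from rho_increasing_range[OF _ _ this cosh_ratio_tendsto_0 cosh_ratio_tendsto_same_sign]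
    show ?case using sp assms by simp
  next
    \<comment> \<open>Negation turns the lower bound on \<open>p\<close> into an upper bound on
      \<open>- p\<close>, and the reciprocal turns increase into decrease. As \<open>p\<close> may
      have either sign, the limit is the reciprocal of a minimum, which is a maximum.\<close>
    case 3
    then have neg: "s < 0" "t < 0" using assms by auto
    have "cosh_ratio s t p y < cosh_ratio s t p x" if "0 < x" "x < y" for x y
    proof -
      have "cosh_ratio (- t) (- s) (- p) x < cosh_ratio (- t) (- s) (- p) y"
        using 3 assms neg that by (intro cosh_ratio_increasing slope_sign_scaled_pos) auto
      then show ?thesis
        using neg assms that cosh_ratio_pos[of "- t" "- s" "- p" x]
        by (simp add: inverse_eq less_imp_inverse_less)
    qed
    moreover have "(cosh_ratio s t p \<longlongrightarrow> inverse (min 1 (2 powr (p / s - p / t)))) at_top"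
      using tendsto_inverse[OF cosh_ratio_tendsto_same_sign[of "- t" "- s" "- p"]] neg assms
      by (simp add: inverse_eq min_def)
    moreover have "inverse (min 1 (2 powr (p / s - p / t))) = max 1 (2 powr (p / t - p / s))"
    proof -
      have "inverse (min 1 x) = max 1 (inverse x)" if "0 < x" for x :: real
        using that by (auto simp: min_def max_def one_le_inverse_iff)
      then show ?thesis by (simp flip: inverse_powr)
    qed
    ultimately show ?case
      using rho_decreasing_range[OF _ _ _ lim0_inverse tendsto_ereal, of "max 1 (2 powr (p / t - p / s))"] neg
      by simp
  next
    case 4
    then have neg: "s < 0" "t < 0" "p < 0" using assms by auto
    have "cosh_ratio s t p x < cosh_ratio s t p y" if "0 < x" "x < y" for x y
    proof -
      have "cosh_ratio (- t) (- s) (- p) y < cosh_ratio (- t) (- s) (- p) x"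
        using 4 assms neg that by (intro cosh_ratio_decreasing slope_sign_scaled_neg) auto
      then show ?thesis
        using neg assms that cosh_ratio_pos[of "- t" "- s" "- p" y]
        by (simp add: inverse_eq less_imp_inverse_less)
    qed
    moreover have "(cosh_ratio s t p \<longlongrightarrow> 2 powr (p / t - p / s)) at_top"
      using tendsto_inverse[OF cosh_ratio_tendsto_pos[of "- t" "- s" "- p"]] neg
      by (simp add: inverse_eq inverse_powr)
    ultimately show ?case
      using rho_increasing_range[OF _ _ _ lim0_inverse] neg by simp
  next
    case 5
    then have sp: "s < 0" "0 < t" "0 < p" using assms by auto
    have "cosh_ratio s t p x < cosh_ratio s t p y" if "0 < x" "x < y" for x y
      using 5 assms sp that by (intro cosh_ratio_increasing slope_sign_scaled_pos_opposite) auto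
    from rho_increasing_range[OF _ _ this cosh_ratio_tendsto_0 cosh_ratio_tendsto_opposite]
    show ?case using sp by simp
  next
    case 6
    then have sp: "s < 0" "0 < t" "p < 0" using assms by auto
    have neg: "cosh_ratio (- t) (- s) (- p) x < 0" if "0 < x" for x
      using sp that by (intro cosh_ratio_neg) auto
    have "cosh_ratio s t p y < cosh_ratio s t p x" if "0 < x" "x < y" for x y
    proof -
      have "cosh_ratio (- t) (- s) (- p) x < cosh_ratio (- t) (- s) (- p) y"
        using 6 assms sp that by (intro cosh_ratio_increasing slope_sign_scaled_pos_opposite) auto
      then show ?thesis
        using neg[of y] that by (simp add: inverse_eq less_imp_inverse_less_neg)
    qed
    \<comment> \<open>The reciprocal quotient tends to 0 through negative values.\<close>
    moreover have "filterlim (cosh_ratio s t p) at_bot at_top"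
      unfolding inverse_eq
    proof (rule filterlim_inverse_at_bot)
      show "(cosh_ratio (- t) (- s) (- p) \<longlongrightarrow> 0) at_top"
        using sp by (intro cosh_ratio_tendsto_opposite) auto
      show "\<forall>\<^sub>F x in at_top. cosh_ratio (- t) (- s) (- p) x < 0"
        using eventually_gt_at_top[of 0] by eventually_elim (rule neg)
    qed
    then have "((\<lambda>x. ereal (cosh_ratio s t p x)) \<longlongrightarrow> - \<infinity>) at_top"
      by (simp add: tendsto_MInfty filterlim_at_bot_dense)
    ultimately show ?case
      using rho_decreasing_range[OF _ _ _ lim0_inverse, of "- \<infinity>"] sp by simp
  qed
qed

end
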